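(* Let the prior be the uniform distribution on $\mathcal{H}$, and let $H'\in\{1,\dots,H\}$. Let $\hat{var}_{H'}(\hat l)=\frac1{H'}\sum_{i=1}^{H'}\left(\frac{\sum_{k=1}^{H'}\hat l_k}{H'}-\hat l_i\right)^2$. Suppose that $\frac{H}{H'4m\delta}-\hat{var}_{H'}(\hat l)>0$, and that the quantities $$q^{\ast}_{i,\mathrm{lin},\chi^2}(H')=\begin{cases}\left[1+\dfrac{\frac{\sum_{k=1}^{H'}\hat l_k}{H'}-\hat l_i}{\sqrt{\frac{H}{H'4m\delta}-\hat{var}_{H'}(\hat l)}}\right]\dfrac1{H'} & i=1,\dots,H',\\[2mm] 0 & i=H'+1,\dots,H\end{cases}$$ satisfy $q^{\ast}_{i,\mathrm{lin},\chi^2}(H')>0$ for $i=1,\dots,H'$. Then among all posteriors with support a subset of $\mathcal{H}$ of size exactly $H'$, the best posterior $Q^{\ast}_{\mathrm{lin},\chi^2}(H')$ (i.e. the one minimizing $B_{\mathrm{lin},\chi^2}$) has its support on the ordered subset consisting of the smallest $H'$ values $\hat l_1\le\dots\le\hat l_{H'}$, and its weights are $(q^{\ast}_{i,\mathrm{lin},\chi^2}(H'))_{i=1}^H$.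
   Context: $\mathcal{H}=\{h_1,\dots,h_H\}$ is a finite set of classifiers with empirical risks in $[0,1]$ indexed so that $\hat l_1\le\dots\le\hat l_H$; $m\ge1$ is an integer (sample size); $\delta\in(0,1)$. A posterior is $Q=(q_1,\dots,q_H)$ with $q_i\ge0$, $\sum_iq_i=1$; its support is $\{h_i:q_i>0\}$. For the uniform prior, $B_{\mathrm{lin},\chi^2}(Q)=\sum_{i=1}^H\hat l_iq_i+\sqrt{\frac{H\sum_{i=1}^Hq_i^2}{4m\delta}}$. *)

theory Defs
  imports Complex_Main "HOL-Combinatorics.Permutations"
begin

text \<open>
  The classifier \<open>h_i\<close> is represented by its index \<open>i \<in> {1..H}\<close>, and a weight vector
  \<open>(q_1, \<dots>, q_H)\<close> by a function on \<open>nat\<close> that vanishes outside \<open>{1..H}\<close>, so that equality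
  of functions is equality of vectors.
\<close>

definition posterior :: "nat \<Rightarrow> (nat \<Rightarrow> real) \<Rightarrow> bool" where
  "posterior H q \<longleftrightarrow>
     (\<forall>i\<in>{1..H}. 0 \<le> q i) \<and> (\<forall>i. i \<notin> {1..H} \<longrightarrow> q i = 0) \<and> (\<Sum>i=1..H. q i) = 1"

definition support :: "nat \<Rightarrow> (nat \<Rightarrow> real) \<Rightarrow> nat set" where
  "support H q = {i \<in> {1..H}. q i > 0}"

definition B_lin_chi2 :: "nat \<Rightarrow> nat \<Rightarrow> real \<Rightarrow> (nat \<Rightarrow> real) \<Rightarrow> (nat \<Rightarrow> real) \<Rightarrow> real" where
  "B_lin_chi2 H m \<delta> l q =
     (\<Sum>i=1..H. l i * q i) + sqrt (real H * (\<Sum>i=1..H. (q i)\<^sup>2) / (4 * real m * \<delta>))"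

definition var_hat :: "nat \<Rightarrow> (nat \<Rightarrow> real) \<Rightarrow> real" where
  "var_hat H' l = 1 / real H' * (\<Sum>i=1..H'. ((\<Sum>k=1..H'. l k) / real H' - l i)\<^sup>2)"

definition q_star :: "nat \<Rightarrow> nat \<Rightarrow> real \<Rightarrow> (nat \<Rightarrow> real) \<Rightarrow> nat \<Rightarrow> nat \<Rightarrow> real" where
  "q_star H m \<delta> l H' i =
     (if i \<in> {1..H'}
      then (1 + ((\<Sum>k=1..H'. l k) / real H' - l i)
                / sqrt (real H / (real H' * 4 * real m * \<delta>) - var_hat H' l)) * (1 / real H')
      else 0)"

text \<open>
  Minimizers of the bound among the posteriors whose support has exactly \<open>H'\<close> elements.
\<close>

definition best_posterior ::
    "nat \<Rightarrow> nat \<Rightarrow> real \<Rightarrow> (nat \<Rightarrow> real) \<Rightarrow> nat \<Rightarrow> (nat \<Rightarrow> real) \<Rightarrow> bool" where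
  "best_posterior H m \<delta> l H' =
     is_arg_min (B_lin_chi2 H m \<delta> l) (\<lambda>q. posterior H q \<and> card (support H q) = H')"

end

theory Submission
  imports Defs
begin

text \<open>
  Write \<open>c = H / (4 m \<delta>)\<close>, so that the objective is \<open>\<Sum> l\<^sub>i q\<^sub>i + sqrt (c \<Sum> q\<^sub>i\<^sup>2)\<close>.  The proof separates
  the choice of the weights from the choice of the support.

  \<^item> For a fixed index set \<open>A\<close> with \<open>n\<close> elements, put \<open>\<mu> = (\<Sum> l\<^sub>i) / n\<close> and
    \<open>r = sqrt (c / n - var)\<close>.  The weights \<open>w\<^sub>i = (1 + (\<mu> - l\<^sub>i) / r) / n\<close> are affine in \<open>l\<^sub>i\<close>, hence
    \<open>n r \<Sum> q\<^sub>i w\<^sub>i = r + \<mu> - \<Sum> l\<^sub>i q\<^sub>i\<close> whenever \<open>\<Sum> q\<^sub>i = 1\<close>.  Moreover \<open>sqrt (c \<Sum> w\<^sub>i\<^sup>2) = c / (n r)\<close>.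
    The Cauchy-Schwarz inequality for \<open>q\<close> and \<open>w\<close> therefore reads
    \<open>sqrt (c \<Sum> q\<^sub>i\<^sup>2) \<ge> r + \<mu> - \<Sum> l\<^sub>i q\<^sub>i\<close>: the objective is at least \<open>\<mu> + r\<close>.  Equality in
    Cauchy-Schwarz forces \<open>q\<close> to be proportional to \<open>w\<close>, and so \<open>q = w\<close>, because both have sum \<open>1\<close>.

  \<^item> Given a posterior \<open>q\<close> whose support \<open>S\<close> has \<open>n\<close> elements, let \<open>\<sigma>\<close> be the increasing enumeration
    of \<open>S\<close>.  Then \<open>j \<le> \<sigma> j\<close>, and moving the weight of \<open>\<sigma> j\<close> to \<open>j\<close> keeps the quadratic term and
    does not increase the linear one.  Combined with the first part, \<open>q\<close> is at least as bad as the
    optimal weights on \<open>{1..n}\<close>.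

  A minimizer need not equal the optimal weight vector, since classifiers with equal empirical risks
  can be exchanged.  Nothing else can happen: for a minimizer, the transported weights are the optimal
  ones, and every \<open>l (\<sigma> j)\<close> equals \<open>l j\<close>, as all the weights moved are positive.  Thus the pairs
  of risk and weight over \<open>S\<close> form the same multiset as those over \<open>{1..n}\<close>.  The same then holds
  for the complements, where the weights are \<open>0\<close>, and equal multisets of pairs yield the permutation.
\<close>

section \<open>Optimal weights on a fixed index set\<close>

locale risk_with_norm_penalty =
  fixes A :: "'a set" and l :: "'a \<Rightarrow> real" and c n \<mu> r :: real
  assumes finite: "finite A" and nonempty: "A \<noteq> {}"
    and n_eq: "n = real (card A)"
    and mean_eq: "\<mu> = sum l A / n"
    and r_pos: "0 < r"
    and r_sq: "r\<^sup>2 = c / n - (\<Sum>i\<in>A. (\<mu> - l i)\<^sup>2) / n"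
begin

definition objective :: "('a \<Rightarrow> real) \<Rightarrow> real" where
  "objective q = (\<Sum>i\<in>A. l i * q i) + sqrt (c * (\<Sum>i\<in>A. (q i)\<^sup>2))"

definition weight :: "'a \<Rightarrow> real" where
  "weight i = (1 + (\<mu> - l i) / r) / n"

lemma n_pos: "0 < n"
  using finite nonempty by (simp add: n_eq card_gt_0_iff)

lemma c_pos: "0 < c"
proof -
  have "0 < r\<^sup>2 + (\<Sum>i\<in>A. (\<mu> - l i)\<^sup>2) / n"
    using r_pos n_pos by (intro add_pos_nonneg divide_nonneg_pos sum_nonneg) auto
  hence "0 < c / n" by (simp add: r_sq)
  thus ?thesis using n_pos by (simp add: zero_less_divide_iff)
qed

lemma sum_deviations: "(\<Sum>i\<in>A. \<mu> - l i) = 0"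
  using n_pos by (simp add: sum_subtractf mean_eq n_eq)

lemma sum_weight: "sum weight A = 1"
proof -
  have "sum weight A = (\<Sum>i\<in>A. 1 + (\<mu> - l i) / r) / n"
    by (simp add: weight_def sum_divide_distrib)
  also have "(\<Sum>i\<in>A. 1 + (\<mu> - l i) / r) = n + (\<Sum>i\<in>A. \<mu> - l i) / r"
    by (simp add: sum.distrib sum_divide_distrib n_eq)
  finally show ?thesis using n_pos by (simp add: sum_deviations)
qed

text \<open>
  Because \<open>weight\<close> is affine in \<open>l\<close>, an inner product with it is, up to constants, the linear term
  of the objective.  This turns Cauchy-Schwarz into a bound on the objective.
\<close>

lemma inner_weight:
  assumes "sum q A = 1"
  shows "n * r * (\<Sum>i\<in>A. q i * weight i) = r + \<mu> - (\<Sum>i\<in>A. l i * q i)"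
proof -
  have "n * r * (\<Sum>i\<in>A. q i * weight i) = (\<Sum>i\<in>A. (r + \<mu>) * q i - l i * q i)"
    unfolding sum_distrib_left
    by (rule sum.cong) (use n_pos r_pos in \<open>auto simp: weight_def field_simps\<close>)
  thus ?thesis using assms by (simp add: sum_subtractf flip: sum_distrib_left)
qed

lemma sum_weight_sq: "(\<Sum>i\<in>A. (weight i)\<^sup>2) = c / (n * r)\<^sup>2"
proof -
  have "(n * r)\<^sup>2 * (\<Sum>i\<in>A. (weight i)\<^sup>2) = (\<Sum>i\<in>A. r\<^sup>2 + 2 * r * (\<mu> - l i) + (\<mu> - l i)\<^sup>2)"
    unfolding sum_distrib_left
  proof (rule sum.cong)
    fix i
    have "n * r * weight i = r + (\<mu> - l i)"
      using n_pos r_pos by (simp add: weight_def field_simps)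
    thus "(n * r)\<^sup>2 * (weight i)\<^sup>2 = r\<^sup>2 + 2 * r * (\<mu> - l i) + (\<mu> - l i)\<^sup>2"
      by (metis power_mult_distrib power2_sum add.assoc add.commute)
  qed simp
  also have "\<dots> = n * r\<^sup>2 + 2 * r * (\<Sum>i\<in>A. \<mu> - l i) + (\<Sum>i\<in>A. (\<mu> - l i)\<^sup>2)"
    by (simp add: sum.distrib n_eq flip: sum_distrib_left)
  also have "\<dots> = c"
    using n_pos by (simp add: sum_deviations r_sq right_diff_distrib)
  finally show ?thesis using n_pos r_pos by (simp add: field_simps)
qed

text \<open>
  The excess in the Cauchy-Schwarz inequality as a sum of squares, which gives both the inequality
  and its equality case.
\<close>

lemma cauchy_schwarz_excess:
  fixes q w :: "'a \<Rightarrow> real"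
  defines "P \<equiv> \<Sum>i\<in>A. (w i)\<^sup>2" and "Q \<equiv> \<Sum>i\<in>A. (q i)\<^sup>2" and "X \<equiv> \<Sum>i\<in>A. q i * w i"
  shows "(\<Sum>i\<in>A. (P * q i - X * w i)\<^sup>2) = P * (P * Q - X\<^sup>2)"
proof -
  have "(\<Sum>i\<in>A. (P * q i - X * w i)\<^sup>2)
        = (\<Sum>i\<in>A. P\<^sup>2 * (q i)\<^sup>2 - 2 * P * X * (q i * w i) + X\<^sup>2 * (w i)\<^sup>2)"
    by (rule sum.cong) (auto simp: power2_eq_square algebra_simps)
  also have "\<dots> = P\<^sup>2 * Q - 2 * P * X * X + X\<^sup>2 * P"
    by (simp add: sum.distrib sum_subtractf P_def Q_def X_def flip: sum_distrib_left)
  finally show ?thesis by (simp add: power2_eq_square algebra_simps)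
qed

lemma objective_weight: "objective weight = \<mu> + r"
proof -
  have "sqrt (c * (\<Sum>i\<in>A. (weight i)\<^sup>2)) = sqrt ((c / (n * r))\<^sup>2)"
    unfolding sum_weight_sq by (simp add: power_divide power2_eq_square)
  also have "\<dots> = c / (n * r)"
    using c_pos n_pos r_pos by simp
  also have "\<dots> = n * r * (\<Sum>i\<in>A. weight i * weight i)"
    using sum_weight_sq n_pos r_pos by (simp add: power2_eq_square field_simps)
  finally show ?thesis
    using inner_weight[OF sum_weight] by (simp add: objective_def)
qed

lemma
  assumes q: "sum q A = 1"
  shows objective_ge: "\<mu> + r \<le> objective q"
    and objective_eq_imp: "objective q = \<mu> + r \<Longrightarrow> i \<in> A \<Longrightarrow> q i = weight i"
proof -
  define P Q X where "P = (\<Sum>i\<in>A. (weight i)\<^sup>2)" and "Q = (\<Sum>i\<in>A. (q i)\<^sup>2)"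
    and "X = (\<Sum>i\<in>A. q i * weight i)"
  note excess = cauchy_schwarz_excess[of weight q, folded P_def Q_def X_def]
  have P: "P = c / (n * r)\<^sup>2" by (simp add: P_def sum_weight_sq)
  have P_pos: "0 < P" using c_pos n_pos r_pos by (simp add: P)
  have obj: "objective q - (\<mu> + r) = sqrt (c * Q) - n * r * X"
    using inner_weight[OF q] by (simp add: objective_def Q_def X_def)
  \<comment> \<open>in this form \<open>c Q\<close> and \<open>(n r X)\<^sup>2\<close> differ exactly by a positive multiple of \<open>P Q - X\<^sup>2\<close>\<close>
  have c: "c = (n * r)\<^sup>2 * P" using n_pos r_pos by (simp add: P)
  have "0 \<le> P * (P * Q - X\<^sup>2)" by (simp flip: excess add: sum_nonneg)
  hence "X\<^sup>2 \<le> P * Q" using P_pos by (simp add: zero_le_mult_iff)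
  hence "(n * r)\<^sup>2 * X\<^sup>2 \<le> (n * r)\<^sup>2 * (P * Q)" by (intro mult_left_mono) auto
  hence "(n * r * X)\<^sup>2 \<le> c * Q" by (simp add: c power_mult_distrib mult.assoc)
  thus "\<mu> + r \<le> objective q" using obj real_le_rsqrt by fastforce
  show "q i = weight i" if eq: "objective q = \<mu> + r" and i: "i \<in> A"
  proof -
    have "sqrt (c * Q) = n * r * X" using obj eq by simp
    moreover have "0 \<le> c * Q" using c_pos by (simp add: Q_def sum_nonneg)
    ultimately have "c * Q = (n * r * X)\<^sup>2" by (metis real_sqrt_pow2)
    hence "P * Q = X\<^sup>2" using n_pos r_pos by (simp add: c power_mult_distrib)
    hence "(\<Sum>i\<in>A. (P * q i - X * weight i)\<^sup>2) = 0" by (simp add: excess)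
    hence proportional: "P * q j = X * weight j" if "j \<in> A" for j
      using that finite by (simp add: sum_nonneg_eq_0_iff)
    hence "P * sum q A = X * sum weight A" by (simp add: sum_distrib_left)
    hence "P = X" by (simp add: q sum_weight)
    thus ?thesis using proportional[OF i] P_pos by simp
  qed
qed

end

section \<open>Moving a support to the smallest risks\<close>

text \<open>
  Used with \<open>l\<close> monotone: the \<open>j\<close>-th smallest element of the support carries a risk of at least
  \<open>l j\<close>.  In the inductive step, the new largest element \<open>b\<close> is at least the new cardinality,
  because the whole set lies in \<open>{1..b}\<close>.
\<close>

lemma enumeration_dominates_index:
  fixes S :: "nat set"
  assumes "finite S" and "S \<subseteq> {1..}"
  shows "\<exists>\<sigma>. bij_betw \<sigma> {1..card S} S \<and> (\<forall>j\<in>{1..card S}. j \<le> \<sigma> j)"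
  using assms
proof (induction S rule: finite_linorder_max_induct)
  case empty
  show ?case by (simp add: bij_betw_def)
next
  case (insert b S)
  then obtain \<sigma> where \<sigma>: "bij_betw \<sigma> {1..card S} S" and le: "\<forall>j\<in>{1..card S}. j \<le> \<sigma> j"
    by auto
  have b: "b \<notin> S" using insert.hyps by auto
  have "insert b S \<subseteq> {1..b}" using insert.hyps insert.prems by (force intro: less_imp_le)
  hence "card (insert b S) \<le> b" using card_mono[of "{1..b}"] by fastforce
  hence "Suc (card S) \<le> b" using b insert.hyps by simp
  moreover have "bij_betw (\<sigma>(Suc (card S) := b)) ({1..card S} \<union> {Suc (card S)}) (S \<union> {b})"
    using b by (intro bij_betw_combine bij_betw_cong[THEN iffD1, OF _ \<sigma>]) (auto simp: bij_betw_def)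
  moreover have "{1..card S} \<union> {Suc (card S)} = {1..card (insert b S)}"
    using b insert.hyps by auto
  ultimately have "bij_betw (\<sigma>(Suc (card S) := b)) {1..card (insert b S)} (insert b S)"
    by simp
  moreover have "\<forall>j\<in>{1..card (insert b S)}. j \<le> (\<sigma>(Suc (card S) := b)) j"
    using le b insert.hyps \<open>Suc (card S) \<le> b\<close> by auto
  ultimately show ?case by blast
qed

text \<open>
  Each level set of \<open>l\<close> meets \<open>S\<close> and \<open>T\<close> in equally many points, hence also their complements
  in \<open>A\<close>, since \<open>A\<close> is finite.  As \<open>f\<close> and \<open>g\<close> are equal to \<open>z\<close> on these complements, the pairs
  \<open>(l, f)\<close> and \<open>(l, g)\<close> run through the same multiset over \<open>A\<close>, and matching them gives \<open>p\<close>.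
  For posteriors, \<open>S\<close> is the support of a minimizer, \<open>T = {1..n}\<close> and \<open>z = 0\<close>.
\<close>

lemma permutation_extending_level_preserving_bijection:
  fixes f g :: "'a \<Rightarrow> 'b" and l :: "'a \<Rightarrow> 'c"
  assumes A: "finite A" and ST: "S \<subseteq> A" "T \<subseteq> A" and \<sigma>: "bij_betw \<sigma> T S"
    and l: "\<And>j. j \<in> T \<Longrightarrow> l (\<sigma> j) = l j" and fg: "\<And>j. j \<in> T \<Longrightarrow> f (\<sigma> j) = g j"
    and f: "\<And>i. i \<in> A - S \<Longrightarrow> f i = z" and g: "\<And>i. i \<in> A - T \<Longrightarrow> g i = z"
  obtains p where "p permutes A" "\<forall>i\<in>A. l (p i) = l i" "\<forall>i\<in>A. f i = g (p i)"
proof -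
  have split: "mset_set A = mset_set S' + mset_set (A - S')" if "S' \<subseteq> A" for S'
  proof -
    have "finite S'" "finite (A - S')" "S' \<union> (A - S') = A"
      using A that by (auto intro: finite_subset)
    thus ?thesis using mset_set_Union[of S' "A - S'"] by auto
  qed
  have transport: "image_mset h (mset_set S) = image_mset (h \<circ> \<sigma>) (mset_set T)"
    for h :: "'a \<Rightarrow> 'd"
  proof -
    have "mset_set S = image_mset \<sigma> (mset_set T)"
      using \<sigma> by (simp add: bij_betw_def image_mset_mset_set)
    thus ?thesis by (simp add: image_mset.compositionality)
  qed
  have finite_parts: "finite S" "finite T" using A ST finite_subset by auto
  have "image_mset l (mset_set S) = image_mset l (mset_set T)"
    unfolding transport using finite_parts by (intro image_mset_cong) (auto simp: l)
  moreover have "image_mset l (mset_set S) + image_mset l (mset_set (A - S))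
      = image_mset l (mset_set T) + image_mset l (mset_set (A - T))"
    unfolding image_mset_union[symmetric] split[OF ST(1), symmetric] split[OF ST(2), symmetric] ..
  ultimately have "image_mset l (mset_set (A - S)) = image_mset l (mset_set (A - T))" by simp
  hence "image_mset (\<lambda>x. (x, z)) (image_mset l (mset_set (A - S)))
      = image_mset (\<lambda>x. (x, z)) (image_mset l (mset_set (A - T)))" by simp
  hence "image_mset (\<lambda>i. (l i, z)) (mset_set (A - S)) = image_mset (\<lambda>i. (l i, z)) (mset_set (A - T))"
    by (simp add: image_mset.compositionality comp_def)
  moreover have "image_mset (\<lambda>i. (l i, f i)) (mset_set (A - S)) = image_mset (\<lambda>i. (l i, z)) (mset_set (A - S))"
    using A by (intro image_mset_cong) (auto simp: f)
  moreover have "image_mset (\<lambda>i. (l i, g i)) (mset_set (A - T)) = image_mset (\<lambda>i. (l i, z)) (mset_set (A - T))"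
    using A by (intro image_mset_cong) (auto simp: g)
  moreover have "image_mset (\<lambda>i. (l i, f i)) (mset_set S) = image_mset (\<lambda>i. (l i, g i)) (mset_set T)"
    unfolding transport using finite_parts by (intro image_mset_cong) (auto simp: l fg)
  ultimately have "image_mset (\<lambda>i. (l i, f i)) (mset_set A) = image_mset (\<lambda>i. (l i, g i)) (mset_set A)"
    using arg_cong[OF split[OF ST(1)], of "image_mset (\<lambda>i. (l i, f i))"]
      arg_cong[OF split[OF ST(2)], of "image_mset (\<lambda>i. (l i, g i))"]
    by (simp only: image_mset_union)
  from image_mset_eq_implies_permutes[OF A this] obtain p
    where "p permutes A" "\<forall>i\<in>A. (l i, f i) = (l (p i), g (p i))" .
  thus thesis by (intro that[of p]) auto
qed

section \<open>The best posterior of a given support size\<close>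

text \<open>
  Positivity of the weights on \<open>{1..H'}\<close> makes the vector an admissible competitor with support
  of size exactly \<open>H'\<close>, so the lower bound \<open>\<mu> + r\<close>, valid for all competitors, is attained.
\<close>

theorem theorem4:
  fixes H H' m :: nat and \<delta> :: real and l :: "nat \<Rightarrow> real"
  assumes "1 \<le> m" and "0 < \<delta>" and "\<delta> < 1"
    and "\<forall>i\<in>{1..H}. 0 \<le> l i \<and> l i \<le> 1"
    and "mono_on {1..H} l"
    and "H' \<in> {1..H}"
    and "real H / (real H' * 4 * real m * \<delta>) - var_hat H' l > 0"
    and "\<forall>i\<in>{1..H'}. q_star H m \<delta> l H' i > 0"
  shows "best_posterior H m \<delta> l H' (q_star H m \<delta> l H') \<and>
         support H (q_star H m \<delta> l H') = {1..H'} \<and>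
         (\<forall>q. best_posterior H m \<delta> l H' q \<longrightarrow>
            (\<exists>p. p permutes {1..H} \<and> (\<forall>i\<in>{1..H}. l (p i) = l i) \<and>
                 (\<forall>i. q i = q_star H m \<delta> l H' (p i))))"
proof -
  let ?q = "q_star H m \<delta> l H'"
  let ?B = "B_lin_chi2 H m \<delta> l"
  define c where "c = real H / (4 * real m * \<delta>)"
  define \<mu> where "\<mu> = (\<Sum>k=1..H'. l k) / real H'"
  define r where "r = sqrt (real H / (real H' * 4 * real m * \<delta>) - var_hat H' l)"
  have sub: "{1..H'} \<subseteq> {1..H}" using assms(6) by auto
  interpret risk_with_norm_penalty "{1..H'}" l c "real H'" \<mu> r
  proof
    show "r\<^sup>2 = c / real H' - (\<Sum>i\<in>{1..H'}. (\<mu> - l i)\<^sup>2) / real H'"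
      using assms(7) by (simp add: r_def c_def \<mu>_def var_hat_def mult_ac)
  qed (use assms(6,7) in \<open>auto simp: r_def \<mu>_def\<close>)
  have q_star_in: "?q i = weight i" if "i \<in> {1..H'}" for i
    using that unfolding q_star_def weight_def by (simp add: \<mu>_def r_def)
  have q_star_out: "?q i = 0" if "i \<notin> {1..H'}" for i
    using that by (auto simp: q_star_def)

  have sum_q: "(\<Sum>i=1..H. ?q i) = 1"
  proof -
    have "(\<Sum>i=1..H. ?q i) = sum ?q {1..H'}"
      using sub by (intro sum.mono_neutral_right) (auto simp: q_star_out)
    thus ?thesis using sum_weight by (simp add: q_star_in)
  qed
  have supp: "support H ?q = {1..H'}"
    using sub assms(8) q_star_out unfolding support_def by fastforce
  have post: "posterior H ?q"
    unfolding posterior_def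
  proof (intro conjI ballI allI impI)
    show "0 \<le> ?q i" for i
      using assms(8) q_star_out[of i] by (cases "i \<in> {1..H'}") (auto intro: less_imp_le)
    show "?q i = 0" if "i \<notin> {1..H}" for i using that sub by (intro q_star_out) auto
  qed (rule sum_q)
  have B_star: "?B ?q = \<mu> + r"
  proof -
    have "(\<Sum>i=1..H. l i * ?q i) = (\<Sum>i=1..H'. l i * weight i)"
      using sub by (intro sum.mono_neutral_cong_right) (auto simp: q_star_out q_star_in)
    moreover have "(\<Sum>i=1..H. (?q i)\<^sup>2) = (\<Sum>i=1..H'. (weight i)\<^sup>2)"
      using sub by (intro sum.mono_neutral_cong_right) (auto simp: q_star_out q_star_in)
    ultimately show ?thesis
      using objective_weight[unfolded objective_def] by (simp add: B_lin_chi2_def c_def)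
  qed

  have competitor: "\<mu> + r \<le> ?B q \<and> (?B q = \<mu> + r \<longrightarrow>
      (\<exists>p. p permutes {1..H} \<and> (\<forall>i\<in>{1..H}. l (p i) = l i) \<and> (\<forall>i. q i = ?q (p i))))"
    if q: "posterior H q" "card (support H q) = H'" for q
  proof -
    define S where "S = support H q"
    have S: "S \<subseteq> {1..H}" by (auto simp: S_def support_def)
    have q_out: "q i = 0" if "i \<notin> S" for i
      using that q(1) by (force simp: S_def support_def posterior_def)
    have q_in: "0 < q i" if "i \<in> S" for i
      using that by (simp add: S_def support_def)
    have "finite S" "S \<subseteq> {1..}" using S finite_subset by auto
    then obtain \<sigma> where \<sigma>: "bij_betw \<sigma> {1..H'} S" and le: "\<forall>j\<in>{1..H'}. j \<le> \<sigma> j"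
      using enumeration_dominates_index[of S] q(2) by (auto simp: S_def)
    have \<sigma>_in: "\<sigma> j \<in> S" if "j \<in> {1..H'}" for j using \<sigma> that by (auto simp: bij_betw_def)
    have transport: "(\<Sum>i=1..H. F i) = (\<Sum>j=1..H'. F (\<sigma> j))"
      if "\<And>i. q i = 0 \<Longrightarrow> F i = 0" for F :: "nat \<Rightarrow> real"
    proof -
      have "(\<Sum>i=1..H. F i) = sum F S"
        using S q_out that by (intro sum.mono_neutral_right) auto
      thus ?thesis using sum.reindex_bij_betw[OF \<sigma>, of F] by simp
    qed
    have sum_1: "sum (q \<circ> \<sigma>) {1..H'} = 1"
      using transport[of q] q(1) by (simp add: posterior_def)
    \<comment> \<open>the amount by which the linear term drops when the weight of \<open>\<sigma> j\<close> is moved to \<open>j\<close>\<close>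
    define gain where "gain j = (l (\<sigma> j) - l j) * q (\<sigma> j)" for j
    have "?B q = (\<Sum>j=1..H'. l (\<sigma> j) * q (\<sigma> j)) + sqrt (c * (\<Sum>j=1..H'. (q (\<sigma> j))\<^sup>2))"
      using transport[of "\<lambda>i. l i * q i"] transport[of "\<lambda>i. (q i)\<^sup>2"]
      by (simp add: B_lin_chi2_def c_def)
    hence B: "?B q = sum gain {1..H'} + objective (q \<circ> \<sigma>)"
      unfolding objective_def by (simp add: gain_def left_diff_distrib sum_subtractf)
    have l_le: "l j \<le> l (\<sigma> j)" if "j \<in> {1..H'}" for j
      using assms(5) that le \<sigma>_in[OF that] S sub by (intro mono_onD[OF assms(5)]) auto
    have gain: "0 \<le> gain j" if "j \<in> {1..H'}" for j
      using l_le[OF that] q_in[OF \<sigma>_in[OF that]] by (simp add: gain_def)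
    hence gain_sum: "0 \<le> sum gain {1..H'}" by (rule sum_nonneg)
    show ?thesis
    proof (intro conjI impI)
      show "\<mu> + r \<le> ?B q" using B gain_sum objective_ge[OF sum_1] by simp
      assume "?B q = \<mu> + r"
      hence obj: "objective (q \<circ> \<sigma>) = \<mu> + r" and zero: "sum gain {1..H'} = 0"
        using B gain_sum objective_ge[OF sum_1] by auto
      have q_eq: "q (\<sigma> j) = ?q j" if "j \<in> {1..H'}" for j
        using objective_eq_imp[OF sum_1 obj that] q_star_in[OF that] by simp
      have l_eq: "l (\<sigma> j) = l j" if "j \<in> {1..H'}" for j
      proof -
        have "gain j = 0" by (rule sum_nonneg_0[OF _ gain zero that]) auto
        thus ?thesis using q_in[OF \<sigma>_in[OF that]] by (simp add: gain_def)
      qed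
      obtain p where p: "p permutes {1..H}" "\<forall>i\<in>{1..H}. l (p i) = l i" "\<forall>i\<in>{1..H}. q i = ?q (p i)"
        by (rule permutation_extending_level_preserving_bijection
              [OF _ S sub \<sigma>, where l = l and f = q and g = ?q and z = 0])
          (auto simp: l_eq q_eq q_out q_star_out)
      have "q i = ?q (p i)" for i
      proof (cases "i \<in> {1..H}")
        case False
        hence "p i = i" using p(1) by (simp add: permutes_def)
        thus ?thesis using False q(1) post by (simp add: posterior_def)
      qed (use p(3) in blast)
      thus "\<exists>p. p permutes {1..H} \<and> (\<forall>i\<in>{1..H}. l (p i) = l i) \<and> (\<forall>i. q i = ?q (p i))"
        using p by blast
    qed
  qed

  have best: "best_posterior H m \<delta> l H' ?q"
    unfolding best_posterior_def is_arg_min_def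
    using post supp competitor B_star by (auto simp: not_less)
  moreover have "\<exists>p. p permutes {1..H} \<and> (\<forall>i\<in>{1..H}. l (p i) = l i) \<and> (\<forall>i. q i = ?q (p i))"
    if "best_posterior H m \<delta> l H' q" for q
  proof -
    have q: "posterior H q" "card (support H q) = H'"
      using that by (auto simp: best_posterior_def is_arg_min_def)
    have "?B q \<le> ?B ?q"
      using that post supp by (auto simp: best_posterior_def is_arg_min_def not_less)
    hence "?B q = \<mu> + r" using competitor[OF q] B_star by simp
    thus ?thesis using competitor[OF q] by blast
  qed
  ultimately show ?thesis using supp by blast
qed

end
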